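(* Let $\mathcal{G}=(\mathcal{V},\mathcal{E})$ be a strongly connected network with node set $\mathcal{V}=\{1,\dots,n\}$, in which every node has a unique identifier, and let each node $i\in\mathcal{V}$ hold a message $\mathcal{S}_i$. Run the Distributed Selective Flooding (DSF) algorithm on $\mathcal{G}$, and let $\mathcal{I}_i(k)$ be the set of messages held by node $i$ after $k$ communication rounds. (1) If $\mathcal{G}$ is a tree (in which case the undirected version of DSF is used), then after $n-1$ rounds of local communication with its neighbors each node has obtained the messages of all nodes, i.e. $\mathcal{I}_i(n-1)=\{\mathcal{S}_u \mid u\in\mathcal{V}\}$ for all $i\in\mathcal{V}$. (2) If $\mathcal{G}$ is directed (in which case the directed version of DSF is used), then the maximum number of communication rounds needed for every node to obtain the messages of all nodes is $n+d_{\mathcal{G}}-1$, i.e. $\mathcal{I}_i(n+d_{\mathcal{G}}-1)=\{\mathcal{S}_u\mid u\in\mathcal{V}\}$ for all $i\in\mathcal{V}$, where $d_{\mathcal{G}}$ is the diameter of $\mathcal{G}$.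
   Context: Network: $\mathcal{E}\subseteq\mathcal{V}\times\mathcal{V}$, and $(i,j)\in\mathcal{E}$ if and only if node $i$ can directly send messages to node $j$. The out-neighbors of $i$ are $\mathcal{N}_{\text{out}}^i=\{j\mid (i,j)\in\mathcal{E}\}$ and the in-neighbors are $\mathcal{N}_{\text{in}}^i=\{j\mid (j,i)\in\mathcal{E}\}$. The network is undirected if $(i,j)\in\mathcal{E}$ implies $(j,i)\in\mathcal{E}$; then the set of neighbors of $i$ is denoted $\mathcal{N}_i$. $\mathcal{G}$ is strongly connected if there is a directed path between any ordered pair of nodes. The distance between two nodes is the number of edges in a shortest path connecting them, and the diameter $d_{\mathcal{G}}$ is the largest distance between any pair of nodes. A tree is an undirected network that is strongly connected without any cycle. Messages $\mathcal{S}_i$ (scalars, vectors, matrices or sets) carry the identifier of their originating node, so messages originating at different nodes are distinguishable (treated as distinct). DSF algorithm: each node $i$ initializes $\mathcal{I}_i(0)=\{\mathcal{S}_i\}$. Communication proceeds in synchronous rounds $k=1,2,\dots$. In round $k$: - Undirected version: for each neighbor $j\in\mathcal{N}_i$, node $i$ selects an (arbitrary) element $e\in\mathcal{I}_i(k-1)$ such that (a) node $i$ has not sent $e$ to node $j$ before, and (b) node $i$ has not received $e$ from node $j$ before; node $i$ then sends $e$ to $j$. - Directed version: for each $j\in\mathcal{N}_{\text{out}}^i$, node $i$ selects an (arbitrary) element $e\in\mathcal{I}_i(k-1)$ that has not been sent from node $i$ to node $j$ before, and sends $e$ to $j$. If no such element exists, nothing is sent over that link in that round. Then each node $i$ sets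 $\mathcal{I}_i(k)=\mathcal{I}_i(k-1)\cup\{e_j\}$, where $e_j$ ranges over the elements received in round $k$ from its (in-)neighbors $j$. Thus each link carries at most one message per direction per round. *)

theory Defs
  imports "Graph_Theory.Graph_Theory"
begin

definition distance :: "'v pair_pre_digraph \<Rightarrow> 'v \<Rightarrow> 'v \<Rightarrow> nat" where
  "distance G u v = (LEAST m. \<exists>p. pre_digraph.apath G u p v \<and> length p = m)"

definition diameter :: "'v pair_pre_digraph \<Rightarrow> nat" where
  "diameter G = Max ((\<lambda>(u, v). distance G u v) ` (pverts G \<times> pverts G))"

text \<open>
  An undirected network is a symmetric digraph. The two arcs of a single undirected edge
  form a directed cycle (of length 2), which is not a cycle of the undirected network; conversely,
  as there are no parallel arcs, every directed cycle of length 2 arises in this way. The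
  library's \<^const>\<open>tree\<close>, which forbids those cycles too, is therefore not the right notion here.
\<close>
definition undirected_tree :: "'v pair_pre_digraph \<Rightarrow> bool" where
  "undirected_tree G \<longleftrightarrow>
     symmetric G \<and> strongly_connected G \<and>
     \<not> (\<exists>p. pre_digraph.cycle G p \<and> length p \<noteq> 2)"

text \<open>
  The message of node \<open>u\<close> travels as the pair of its originating node and its content, so
  that messages with equal content but different origin are distinct.
\<close>
definition message :: "('v \<Rightarrow> 'm) \<Rightarrow> 'v \<Rightarrow> 'v \<times> 'm" where
  "message S u = (u, S u)"

text \<open>
  \<open>x k i j\<close> is what node \<open>i\<close> sends to node \<open>j\<close> in round \<open>k\<close>, for \<open>k \<ge> 1\<close>. Only its values
  on arcs \<open>(i, j)\<close> and at rounds \<open>k \<ge> 1\<close> are ever used.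
\<close>
type_synonym ('v, 'm) transmissions = "nat \<Rightarrow> 'v \<Rightarrow> 'v \<Rightarrow> ('v \<times> 'm) option"

primrec held ::
  "'v pair_pre_digraph \<Rightarrow> ('v \<Rightarrow> 'm) \<Rightarrow> ('v, 'm) transmissions \<Rightarrow> nat \<Rightarrow> 'v \<Rightarrow> ('v \<times> 'm) set"
where
  "held G S x 0 i = {message S i}"
| "held G S x (Suc k) i =
     held G S x k i \<union> {e. \<exists>j. (j, i) \<in> parcs G \<and> x (Suc k) j i = Some e}"

text \<open>The elements that node \<open>i\<close> may select for node \<open>j\<close> in round \<open>k + 1\<close>.\<close>

definition candidates_directed ::
  "'v pair_pre_digraph \<Rightarrow> ('v \<Rightarrow> 'm) \<Rightarrow> ('v, 'm) transmissions \<Rightarrow> nat \<Rightarrow> 'v \<Rightarrow> 'v \<Rightarrow> ('v \<times> 'm) set"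
where
  "candidates_directed G S x k i j =
     {e \<in> held G S x k i. \<forall>r\<in>{1..k}. x r i j \<noteq> Some e}"

definition candidates_undirected ::
  "'v pair_pre_digraph \<Rightarrow> ('v \<Rightarrow> 'm) \<Rightarrow> ('v, 'm) transmissions \<Rightarrow> nat \<Rightarrow> 'v \<Rightarrow> 'v \<Rightarrow> ('v \<times> 'm) set"
where
  "candidates_undirected G S x k i j =
     {e \<in> held G S x k i. \<forall>r\<in>{1..k}. x r i j \<noteq> Some e \<and> x r j i \<noteq> Some e}"

definition selects :: "'e option \<Rightarrow> 'e set \<Rightarrow> bool" where
  "selects c A \<longleftrightarrow> (case c of None \<Rightarrow> A = {} | Some e \<Rightarrow> e \<in> A)"

definition dsf_directed_run ::
  "'v pair_pre_digraph \<Rightarrow> ('v \<Rightarrow> 'm) \<Rightarrow> ('v, 'm) transmissions \<Rightarrow> bool"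
where
  "dsf_directed_run G S x \<longleftrightarrow>
     (\<forall>k. \<forall>(i, j)\<in>parcs G. selects (x (Suc k) i j) (candidates_directed G S x k i j))"

definition dsf_undirected_run ::
  "'v pair_pre_digraph \<Rightarrow> ('v \<Rightarrow> 'm) \<Rightarrow> ('v, 'm) transmissions \<Rightarrow> bool"
where
  "dsf_undirected_run G S x \<longleftrightarrow>
     (\<forall>k. \<forall>(i, j)\<in>parcs G. selects (x (Suc k) i j) (candidates_undirected G S x k i j))"

end

theory Submission
  imports Defs
begin

text \<open>
  Whenever a node holds messages that are still eligible for a link, that link carries a new
  message in the next round. The messages sent over a link are therefore counted, and a link
  that has not yet sent a message available to it has sent many others instead.

  \<^emph>\<open>Directed networks.\<close> Let \<open>u\<close> be joined to \<open>v\<close> by a walk of length \<open>l\<close>. After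
  \<open>l + m\<close> rounds, \<open>v\<close> holds the message of \<open>u\<close> or more than \<open>m\<close> messages (lemma
  \<open>directed_progress\<close>). This follows by induction on \<open>l\<close>: at each of the times
  \<open>l - 1 + m'\<close> with \<open>m' \<le> m\<close>, the last node \<open>w\<close> before \<open>v\<close> holds the message of
  \<open>u\<close> or more than \<open>m'\<close> messages, so as long as the message of \<open>u\<close> has not been sent to
  \<open>v\<close>, at least \<open>m' + 1\<close> others have been sent by the next round. With \<open>l\<close> the distance,
  which is at most the diameter, and \<open>m = n - 1\<close>, either case gives that \<open>v\<close> holds the message
  of \<open>u\<close> after \<open>n + d - 1\<close> rounds, since there are only \<open>n\<close> messages.

  \<^emph>\<open>Trees.\<close> Removing the edge between \<open>p\<close> and \<open>q\<close> splits a tree into two parts; let the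
  branch \<open>B p q\<close> be the part that contains \<open>p\<close>. It consists of \<open>p\<close> and the branches \<open>B c p\<close>
  for the other neighbors \<open>c\<close> of \<open>p\<close> (lemma \<open>branch_decomp\<close>). Only messages that
  originate in \<open>B p q\<close> travel from \<open>p\<close> to \<open>q\<close>, because no message is returned over a link
  (lemma \<open>sent_subset_branch\<close>); so a message of \<open>B p q\<close> is never blocked at \<open>p\<close> for having
  arrived from \<open>q\<close>. The link from \<open>p\<close> to \<open>q\<close> is in fact never idle before it has carried all
  of \<open>B p q\<close> (lemma \<open>undirected_progress\<close>, by induction on the size of the branch): if it idles
  in round \<open>k + 1\<close>, it has already carried the message of \<open>p\<close> and everything that \<open>p\<close> received
  from its other neighbors. Either these have delivered their branches completely, and then so has
  \<open>p\<close>, or one of them has been busy for \<open>k\<close> rounds, and together with the message of \<open>p\<close> this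
  makes \<open>k + 1\<close> messages, too many for \<open>k\<close> rounds. A branch has at most \<open>n - 1\<close> nodes, so
  all links are finished after \<open>n - 1\<close> rounds.
\<close>

section \<open>Branches of a tree\<close>

text \<open>
  Cutting a walk at its first arrival at \<open>p\<close> leaves a walk outside \<open>p\<close> to a predecessor of \<open>p\<close>.
\<close>

lemma rtrancl_first_arrival:
  assumes "(u, p) \<in> R\<^sup>*" "u \<noteq> p"
  obtains c where "(c, p) \<in> R" "c \<noteq> p" "(u, c) \<in> (Restr R (- {p}))\<^sup>*"
proof -
  have "\<exists>c. (c, p) \<in> R \<and> c \<noteq> p \<and> (u, c) \<in> (Restr R (- {p}))\<^sup>*"
    using assms
  proof (induction rule: converse_rtrancl_induct)
    case base
    then show ?case by simp
  next
    case (step u u')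
    show ?case
    proof (cases "u' = p")
      case True
      with step show ?thesis by auto
    next
      case False
      with step obtain c where c: "(c, p) \<in> R" "c \<noteq> p" "(u', c) \<in> (Restr R (- {p}))\<^sup>*"
        by blast
      have "(u, u') \<in> Restr R (- {p})"
        using step False by simp
      with c show ?thesis
        by (meson converse_rtrancl_into_rtrancl)
    qed
  qed
  then show ?thesis using that by blast
qed

text \<open>A finite or infinite network that is a tree.\<close>

locale tree_network = pair_wf_digraph +
  assumes tree: "undirected_tree G"
begin

text \<open>The arcs that remain when the node \<open>q\<close> is removed.\<close>

abbreviation avoiding :: "'a \<Rightarrow> ('a \<times> 'a) set" where
  "avoiding q \<equiv> Restr (parcs G) (- {q})"

text \<open>
  For an edge between \<open>p\<close> and \<open>q\<close>, the nodes on the side of \<open>p\<close>, given as those that reach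
  \<open>p\<close> after the removal of \<open>q\<close>. As no arc between the sides other than \<open>(p, q)\<close> and
  \<open>(q, p)\<close> exists in a tree, this agrees with removing the edge only. The explicit exclusion of
  \<open>q\<close> and of elements outside the node set matters only for the reflexive case of the closure.
\<close>

definition branch :: "'a \<Rightarrow> 'a \<Rightarrow> 'a set" where
  "branch p q = {u \<in> pverts G - {q}. (u, p) \<in> (avoiding q)\<^sup>*}"

lemma arc_sym: "(p, q) \<in> parcs G \<Longrightarrow> (q, p) \<in> parcs G"
  using tree by (auto simp: undirected_tree_def symmetric_def dest: symD)

lemma avoiding_sym: "(u, v) \<in> (avoiding q)\<^sup>* \<Longrightarrow> (v, u) \<in> (avoiding q)\<^sup>*"
proof -
  have "sym (avoiding q)"
    using arc_sym by (auto intro!: symI)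
  then show "(u, v) \<in> (avoiding q)\<^sup>* \<Longrightarrow> (v, u) \<in> (avoiding q)\<^sup>*"
    using sym_rtrancl symD by metis
qed

lemma cycle_length: "cycle w \<Longrightarrow> length w = 2"
  using tree by (auto simp: undirected_tree_def)

lemma no_loop: "(p, p) \<notin> parcs G"
proof
  assume "(p, p) \<in> parcs G"
  then have "cycle [(p, p)]"
    using in_arcsD1 by (auto simp: cycle_def awalk_simps)
  then show False
    using cycle_length by fastforce
qed

lemma avoiding_apath:
  assumes "(c, d) \<in> (avoiding p)\<^sup>*" "c \<in> pverts G" "c \<noteq> p"
  obtains w where "apath c w d" "p \<notin> set (pawalk_verts c w)"
proof -
  have "\<exists>w. awalk c w d \<and> p \<notin> set (pawalk_verts c w)"
    using assms
  proof (induction rule: converse_rtrancl_induct)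
    case base
    then show ?case by (intro exI[of _ "[]"]) (simp add: awalk_simps)
  next
    case (step c c')
    then obtain w where "awalk c' w d" "p \<notin> set (pawalk_verts c' w)"
      using in_arcsD2 by blast
    with step show ?case
      by (intro exI[of _ "(c, c') # w"]) (auto simp: awalk_simps)
  qed
  then obtain w where w: "awalk c w d" "p \<notin> set (pawalk_verts c w)"
    by blast
  have ap: "apath c (awalk_to_apath w) d"
    using w(1) by (rule apath_awalk_to_apath)
  have "set (pawalk_verts c (awalk_to_apath w)) \<subseteq> set (pawalk_verts c w)"
    using set_awalk_verts[OF w(1)] set_awalk_verts[OF awalkI_apath[OF ap]]
      awalk_to_apath_subset[OF w(1)] by auto
  with ap w(2) show ?thesis
    using that by blast
qed

text \<open>
  The only use of acyclicity apart from \<open>no_loop\<close>: two distinct neighbors of \<open>p\<close> joined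
  outside \<open>p\<close> would close a cycle of length at least 3 through \<open>p\<close>.
\<close>

lemma neighbors_separated:
  assumes "(c, p) \<in> parcs G" "(d, p) \<in> parcs G" "(c, d) \<in> (avoiding p)\<^sup>*"
  shows "c = d"
proof (rule ccontr)
  assume "c \<noteq> d"
  have "c \<noteq> p"
    using assms(1) no_loop by blast
  with assms obtain w where w: "apath c w d" "p \<notin> set (pawalk_verts c w)"
    using avoiding_apath in_arcsD1 by metis
  from w(1) \<open>c \<noteq> d\<close> have "w \<noteq> []"
    by (auto simp: apath_simps)
  let ?w = "(p, c) # w @ [(d, p)]"
  have "awalk c w d"
    using w(1) by (rule awalkI_apath)
  then have walk: "awalk c (w @ [(d, p)]) p"
    using assms(2) in_arcsD2 by (intro awalk_appendI) (auto simp: awalk_simps)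
  have "pawalk_verts c (w @ [(d, p)]) = pawalk_verts c w @ [p]"
    using awalk_verts_append[OF walk] \<open>awalk c w d\<close> by auto
  then have "cycle ?w"
    using walk w arc_sym[OF assms(1)]
    by (auto simp: cycle_def awalk_Cons_iff apath_def intro!: exI[of _ p])
  then show False
    using cycle_length \<open>w \<noteq> []\<close> by fastforce
qed

lemma branch_subset: "branch p q \<subseteq> pverts G - {q}"
  by (auto simp: branch_def)

lemma branch_child_avoids:
  assumes "(u, c) \<in> (avoiding p)\<^sup>*" "(c, p) \<in> parcs G" "(q, p) \<in> parcs G" "c \<noteq> q"
  shows "u \<noteq> q \<and> (u, c) \<in> (avoiding q)\<^sup>*"
  using assms(1)
proof (induction rule: converse_rtrancl_induct)
  case base
  then show ?case using assms by simp
next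
  case (step u u')
  then have "(u, c) \<in> (avoiding p)\<^sup>*"
    by (meson converse_rtrancl_into_rtrancl)
  then have "u \<noteq> q"
    using neighbors_separated[of q p c] assms by blast
  with step have "(u, u') \<in> avoiding q"
    by simp
  with step \<open>u \<noteq> q\<close> show ?case
    by (meson converse_rtrancl_into_rtrancl)
qed

lemma branch_decomp:
  assumes "(p, q) \<in> parcs G"
  shows "branch p q = insert p (\<Union>c\<in>{c. (c, p) \<in> parcs G \<and> c \<noteq> q}. branch c p)"
proof (intro equalityI subsetI)
  fix u assume u: "u \<in> branch p q"
  show "u \<in> insert p (\<Union>c\<in>{c. (c, p) \<in> parcs G \<and> c \<noteq> q}. branch c p)"
  proof (cases "u = p")
    case False
    then obtain c where "(c, p) \<in> avoiding q" "(u, c) \<in> (Restr (avoiding q) (- {p}))\<^sup>*"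
      using u rtrancl_first_arrival[of u p "avoiding q"] unfolding branch_def by blast
    moreover have "(Restr (avoiding q) (- {p}))\<^sup>* \<subseteq> (avoiding p)\<^sup>*"
      by (intro rtrancl_mono) auto
    ultimately show ?thesis
      using u False by (auto simp: branch_def)
  qed simp
next
  fix u assume u: "u \<in> insert p (\<Union>c\<in>{c. (c, p) \<in> parcs G \<and> c \<noteq> q}. branch c p)"
  have "p \<noteq> q"
    using assms no_loop by blast
  show "u \<in> branch p q"
  proof (cases "u = p")
    case True
    then show ?thesis
      using assms \<open>p \<noteq> q\<close> in_arcsD1 by (auto simp: branch_def)
  next
    case False
    with u obtain c where c: "(c, p) \<in> parcs G" "c \<noteq> q" "u \<in> branch c p"
      by blast
    then have "u \<noteq> q \<and> (u, c) \<in> (avoiding q)\<^sup>*"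
      using branch_child_avoids[of u c p q] arc_sym[OF assms] by (simp add: branch_def)
    moreover have "(c, p) \<in> avoiding q"
      using c \<open>p \<noteq> q\<close> by simp
    ultimately show ?thesis
      using c(3) rtrancl_into_rtrancl[of u c] by (simp add: branch_def)
  qed
qed

lemma branch_disjoint:
  assumes "(p, q) \<in> parcs G"
  shows "branch p q \<inter> branch q p = {}"
proof -
  have False if u: "u \<in> branch p q" "u \<in> branch q p" for u
  proof -
    have "u \<noteq> p"
      using u(2) by (auto simp: branch_def)
    with u(1) obtain c where c: "(c, p) \<in> parcs G" "c \<noteq> q" "u \<in> branch c p"
      using branch_decomp[OF assms] by blast
    then have "(c, q) \<in> (avoiding p)\<^sup>*"
      using u(2) avoiding_sym[of u c p] by (auto simp: branch_def)
    then show False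
      using neighbors_separated c arc_sym[OF assms] by blast
  qed
  then show ?thesis by blast
qed

lemma verts_eq_branches:
  assumes "i \<in> pverts G"
  shows "pverts G = insert i (\<Union>c\<in>{c. (c, i) \<in> parcs G}. branch c i)"
proof -
  have "u \<in> (\<Union>c\<in>{c. (c, i) \<in> parcs G}. branch c i)" if u: "u \<in> pverts G" "u \<noteq> i" for u
  proof -
    have "u \<rightarrow>\<^sup>*\<^bsub>with_proj G\<^esub> i"
      using tree u(1) assms by (simp add: undirected_tree_def strongly_connected_def)
    then have "(u, i) \<in> (parcs G)\<^sup>*"
      unfolding reachable_def by (simp add: rtrancl_on_rtranclI)
    then obtain c where "(c, i) \<in> parcs G" "(u, c) \<in> (avoiding i)\<^sup>*"
      using rtrancl_first_arrival u(2) by metis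
    then show ?thesis
      using u by (auto simp: branch_def)
  qed
  then show ?thesis
    using assms branch_subset by blast
qed

end

section \<open>Messages sent over a link\<close>

text \<open>The messages that node \<open>i\<close> has sent to node \<open>j\<close> in the rounds \<open>1, \<dots>, k\<close>.\<close>

definition sent :: "('v, 'm) transmissions \<Rightarrow> nat \<Rightarrow> 'v \<Rightarrow> 'v \<Rightarrow> ('v \<times> 'm) set" where
  "sent x k i j = {e. \<exists>r\<in>{1..k}. x r i j = Some e}"

lemma sent_0 [simp]: "sent x 0 i j = {}"
  by (simp add: sent_def)

lemma sent_Suc: "sent x (Suc k) i j = sent x k i j \<union> set_option (x (Suc k) i j)"
proof -
  have "{1..Suc k} = insert (Suc k) {1..k}"
    by auto
  then show ?thesis
    by (auto simp: sent_def)
qed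

lemma finite_sent [simp]: "finite (sent x k i j)"
  by (induction k) (auto simp: sent_Suc)

lemma sent_mono: "k \<le> l \<Longrightarrow> sent x k i j \<subseteq> sent x l i j"
  unfolding sent_def by force

lemma candidates_directed_eq:
  "candidates_directed G S x k i j = held G S x k i - sent x k i j"
  by (auto simp: candidates_directed_def sent_def)

lemma candidates_undirected_eq:
  "candidates_undirected G S x k i j = held G S x k i - sent x k i j - sent x k j i"
  by (auto simp: candidates_undirected_def sent_def)

lemma held_eq: "held G S x k i = insert (message S i) (\<Union>j\<in>{j. (j, i) \<in> parcs G}. sent x k j i)"
  by (induction k) (auto simp: sent_Suc)

lemma held_mono: "k \<le> l \<Longrightarrow> held G S x k i \<subseteq> held G S x l i"
  unfolding held_eq using sent_mono[of k l x] by blast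

lemma inj_message: "inj (message S)"
  by (auto simp: inj_def message_def)

lemma selects_subset: "selects c A \<Longrightarrow> set_option c \<subseteq> A"
  by (auto simp: selects_def)

lemma card_sent_Suc:
  assumes "selects (x (Suc k) i j) A" "A \<inter> sent x k i j = {}" "A \<noteq> {}"
  shows "card (sent x (Suc k) i j) = Suc (card (sent x k i j))"
  using assms by (cases "x (Suc k) i j") (auto simp: selects_def sent_Suc card_insert_if)

section \<open>Directed networks\<close>

context pair_wf_digraph
begin

lemma held_subset_messages:
  assumes run: "dsf_directed_run G S x" and "i \<in> pverts G"
  shows "held G S x k i \<subseteq> message S ` pverts G"
  using \<open>i \<in> pverts G\<close>
proof (induction k arbitrary: i)
  case 0
  then show ?case by simp
next
  case (Suc k)
  have "e \<in> message S ` pverts G" if "(j, i) \<in> parcs G" "x (Suc k) j i = Some e" for j e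
  proof -
    have "selects (x (Suc k) j i) (candidates_directed G S x k j i)"
      using run that(1) by (auto simp: dsf_directed_run_def)
    then have "e \<in> held G S x k j"
      using that(2) by (simp add: selects_def candidates_directed_eq)
    then show ?thesis
      using Suc.IH in_arcsD1[OF that(1)] by blast
  qed
  with Suc show ?case by auto
qed

lemma awalk_snocE:
  assumes "awalk u (p @ [e]) v"
  obtains w where "awalk u p w" "(w, v) \<in> parcs G"
  using assms by (cases e) (auto simp: awalk_simps)

text \<open>
  The statement is a disjunction because the selection is arbitrary: a node may give preference to
  other messages over that of \<open>u\<close>, but these are pairwise distinct, and all of them reach \<open>v\<close>.
\<close>

lemma directed_progress:
  assumes run: "dsf_directed_run G S x" and fin: "finite (pverts G)" and "awalk u p v"
  shows "message S u \<in> held G S x (length p + m) v \<or> m < card (held G S x (length p + m) v)"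
  using \<open>awalk u p v\<close>
proof (induction p arbitrary: v m rule: rev_induct)
  case Nil
  then have "u = v" by (simp add: awalk_simps)
  then show ?case by (simp add: held_eq)
next
  case (snoc e p)
  \<comment> \<open>\<open>w\<close> is the last node before \<open>v\<close>; its link to \<open>v\<close> is to be counted.\<close>
  then obtain w where w: "awalk u p w" and arc: "(w, v) \<in> parcs G"
    by (elim awalk_snocE)
  let ?sent = "\<lambda>k. sent x k w v" and ?held = "\<lambda>k. held G S x k w"
  have sel: "selects (x (Suc k) w v) (?held k - ?sent k)" for k
    using run arc by (auto simp: dsf_directed_run_def candidates_directed_eq)
  have sends: "card (?sent (Suc k)) = Suc (card (?sent k))" if "\<not> ?held k \<subseteq> ?sent k" for k
    using that by (intro card_sent_Suc[where A = "?held k - ?sent k"] sel) auto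
  have "message S u \<in> ?sent (length p + m) \<or> m \<le> card (?sent (length p + m))" for m
  proof (induction m)
    case 0
    show ?case by simp
  next
    case (Suc m)
    let ?k = "length p + m"
    have mono: "?sent ?k \<subseteq> ?sent (Suc ?k)"
      by (simp add: sent_mono)
    show ?case
    proof (cases "?held ?k \<subseteq> ?sent ?k")
      case True
      \<comment> \<open>The link has caught up with \<open>w\<close>, so the induction hypothesis for \<open>w\<close> carries over.\<close>
      then have "card (?held ?k) \<le> card (?sent ?k)"
        by (intro card_mono) auto
      also have "\<dots> \<le> card (?sent (Suc ?k))"
        using mono by (intro card_mono) auto
      finally have "card (?held ?k) \<le> card (?sent (Suc ?k))" .
      with snoc.IH[OF w, of m] True mono show ?thesis
        by auto
    next
      case False
      with Suc sends[of ?k] mono show ?thesis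
        by auto
    qed
  qed
  from this[of "Suc m"]
  have "message S u \<in> ?sent (Suc (length p + m)) \<or> m < card (?sent (Suc (length p + m)))"
    by auto
  moreover have "?sent (Suc (length p + m)) \<subseteq> held G S x (length (p @ [e]) + m) v"
    using arc by (auto simp: held_eq)
  moreover have "finite (held G S x (length (p @ [e]) + m) v)"
    using finite_subset[OF held_subset_messages[OF run in_arcsD2[OF arc]]] fin by blast
  ultimately show ?case
    by (meson card_mono less_le_trans subsetD)
qed

lemma ex_apath_distance:
  assumes "strongly_connected G" "u \<in> pverts G" "v \<in> pverts G"
  obtains p where "apath u p v" "length p = distance G u v"
proof -
  have "u \<rightarrow>\<^sup>*\<^bsub>with_proj G\<^esub> v"
    using assms by (simp add: strongly_connected_def)
  then have "\<exists>m p. apath u p v \<and> length p = m"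
    by (simp add: reachable_apath)
  then have "\<exists>p. apath u p v \<and> length p = distance G u v"
    unfolding distance_def by (rule LeastI_ex)
  then show ?thesis using that by blast
qed

lemma distance_le_diameter:
  assumes "finite (pverts G)" "u \<in> pverts G" "v \<in> pverts G"
  shows "distance G u v \<le> diameter G"
  unfolding diameter_def using assms by (intro Max_ge) auto

theorem directed_complete:
  assumes run: "dsf_directed_run G S x" and fin: "finite (pverts G)"
    and conn: "strongly_connected G" and i: "i \<in> pverts G"
  shows "held G S x (card (pverts G) + diameter G - 1) i = message S ` pverts G"
proof
  let ?n = "card (pverts G)"
  let ?K = "?n + diameter G - 1"
  show sub: "held G S x ?K i \<subseteq> message S ` pverts G"
    using held_subset_messages[OF run i] .
  show "message S ` pverts G \<subseteq> held G S x ?K i"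
  proof
    fix e assume "e \<in> message S ` pverts G"
    then obtain u where u: "u \<in> pverts G" "e = message S u"
      by blast
    obtain p where p: "apath u p i" "length p = distance G u i"
      using ex_apath_distance[OF conn u(1) i] .
    have n: "?n > 0"
      using fin i by (auto simp: card_gt_0_iff)
    have le: "length p + (?n - 1) \<le> ?K"
      using distance_le_diameter[OF fin u(1) i] p(2) n by simp
    have card_M: "card (message S ` pverts G) = ?n"
      by (rule card_image) (rule inj_on_subset[OF inj_message subset_UNIV])
    from directed_progress[OF run fin awalkI_apath[OF p(1)], of "?n - 1"]
    show "e \<in> held G S x ?K i"
    proof
      assume "message S u \<in> held G S x (length p + (?n - 1)) i"
      then show ?thesis
        using subsetD[OF held_mono[OF le]] u(2) by simp
    next
      assume "?n - 1 < card (held G S x (length p + (?n - 1)) i)"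
      also have "\<dots> \<le> card (held G S x ?K i)"
        using finite_subset[OF sub] fin held_mono[OF le, of G S x i] by (intro card_mono) auto
      finally have "card (message S ` pverts G) \<le> card (held G S x ?K i)"
        using card_M by simp
      with finite_imageI[OF fin] sub have "held G S x ?K i = message S ` pverts G"
        by (rule card_seteq)
      then show ?thesis
        using u by simp
    qed
  qed
qed

end

section \<open>Undirected trees\<close>

context tree_network
begin

text \<open>
  What \<open>p\<close> may send to \<open>q\<close> is its own message or came from a neighbor other than \<open>q\<close>.
\<close>

lemma sent_subset_branch:
  assumes run: "dsf_undirected_run G S x" and "(p, q) \<in> parcs G"
  shows "sent x k p q \<subseteq> message S ` branch p q"
  using \<open>(p, q) \<in> parcs G\<close>
proof (induction k arbitrary: p q)
  case 0
  then show ?case by simp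
next
  case (Suc k)
  have "selects (x (Suc k) p q) (held G S x k p - sent x k p q - sent x k q p)"
    using run Suc.prems by (auto simp: dsf_undirected_run_def candidates_undirected_eq)
  then have "set_option (x (Suc k) p q) \<subseteq> held G S x k p - sent x k q p"
    using selects_subset by blast
  also have "\<dots> \<subseteq> insert (message S p) (\<Union>c\<in>{c. (c, p) \<in> parcs G \<and> c \<noteq> q}. sent x k c p)"
    by (auto simp: held_eq)
  also have "\<dots> \<subseteq> message S ` branch p q"
    using Suc.IH branch_decomp[OF Suc.prems] by blast
  finally show ?case
    using Suc by (simp add: sent_Suc)
qed

text \<open>
  The link from \<open>p\<close> to \<open>q\<close> has been busy in all rounds so far unless it has finished.
\<close>

lemma undirected_progress:
  assumes run: "dsf_undirected_run G S x" and fin: "finite (pverts G)" and "(p, q) \<in> parcs G"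
  shows "sent x k p q = message S ` branch p q \<or> k \<le> card (sent x k p q)"
  using \<open>(p, q) \<in> parcs G\<close>
proof (induction "card (branch p q)" arbitrary: p q k rule: less_induct)
  case less
  note arc = \<open>(p, q) \<in> parcs G\<close>
  \<comment> \<open>\<open>?C\<close> are the neighbors from which \<open>p\<close> collects its branch.\<close>
  let ?C = "{c. (c, p) \<in> parcs G \<and> c \<noteq> q}"
  have child: "sent x k c p = message S ` branch c p \<or> k \<le> card (sent x k c p)" if "c \<in> ?C" for c k
  proof (rule less.hyps)
    have "branch c p \<subset> branch p q"
      using that branch_decomp[OF arc] branch_subset[of c p] by blast
    moreover have "finite (branch p q)"
      using fin branch_subset finite_subset by (metis finite_Diff)
    ultimately show "card (branch c p) < card (branch p q)"
      by (intro psubset_card_mono)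
  qed (use that in simp)
  show ?case
  proof (induction k)
    case 0
    show ?case by simp
  next
    case (Suc k)
    let ?A = "held G S x k p - sent x k p q - sent x k q p"
    have sel: "selects (x (Suc k) p q) ?A"
      using run arc by (auto simp: dsf_undirected_run_def candidates_undirected_eq)
    have mono: "sent x k p q \<subseteq> sent x (Suc k) p q"
      by (simp add: sent_mono)
    have sub: "sent x j p q \<subseteq> message S ` branch p q" for j
      using sent_subset_branch[OF run arc] .
    consider "sent x k p q = message S ` branch p q"
      | "k \<le> card (sent x k p q)" "?A \<noteq> {}"
      | "?A = {}"
      using Suc.IH by blast
    then show ?case
    proof cases
      case 1
      then show ?thesis
        using mono sub[of "Suc k"] by blast
    next
      case 2
      then have "card (sent x (Suc k) p q) = Suc (card (sent x k p q))"
        by (intro card_sent_Suc[where A = ?A] sel) auto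
      with 2 show ?thesis by simp
    next
      case 3
      \<comment> \<open>The link is idle, so all that \<open>p\<close> holds from its branch has already been sent.\<close>
      define H where "H = insert (message S p) (\<Union>c\<in>?C. sent x k c p)"
      have H_branch: "H \<subseteq> message S ` branch p q"
        unfolding H_def using sent_subset_branch[OF run] branch_decomp[OF arc] by blast
      have "sent x k q p \<subseteq> message S ` branch q p"
        using sent_subset_branch[OF run arc_sym[OF arc]] .
      moreover have "message S ` branch p q \<inter> message S ` branch q p = {}"
        using branch_disjoint[OF arc] image_Int[OF inj_message[of S]] by (metis image_empty)
      moreover have "H \<subseteq> held G S x k p"
        by (auto simp: H_def held_eq)
      moreover have "held G S x k p \<subseteq> sent x k p q \<union> sent x k q p"
        using 3 by blast
      ultimately have H_sent: "H \<subseteq> sent x k p q"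
        using H_branch by (simp add: subset_iff disjoint_iff) metis
      show ?thesis
      proof (cases "\<forall>c\<in>?C. sent x k c p = message S ` branch c p")
        case True
        then have "H = message S ` branch p q"
          unfolding branch_decomp[OF arc] H_def by (simp add: image_UN)
        then show ?thesis
          using H_sent mono sub[of "Suc k"] by blast
      next
        case False
        \<comment> \<open>The at least \<open>k\<close> messages from an unfinished neighbor do not include that of \<open>p\<close> itself.\<close>
        then obtain c where c: "c \<in> ?C" "k \<le> card (sent x k c p)"
          using child by blast
        have "message S p \<notin> sent x k c p"
        proof
          assume "message S p \<in> sent x k c p"
          then have "p \<in> branch c p"
            using subsetD[OF sent_subset_branch[OF run]] c(1)
              inj_image_mem_iff[OF inj_message] by fast
          then show False
            using branch_subset by blast
        qed
        then have "Suc k \<le> card (insert (message S p) (sent x k c p))"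
          using c(2) by simp
        also have "\<dots> \<le> card (sent x (Suc k) p q)"
          using H_sent mono c(1) by (intro card_mono) (auto simp: H_def)
        finally show ?thesis ..
      qed
    qed
  qed
qed

theorem undirected_complete:
  assumes run: "dsf_undirected_run G S x" and fin: "finite (pverts G)" and i: "i \<in> pverts G"
  shows "held G S x (card (pverts G) - 1) i = message S ` pverts G"
proof -
  let ?k = "card (pverts G) - 1"
  have "sent x ?k c i = message S ` branch c i" if arc: "(c, i) \<in> parcs G" for c
    using undirected_progress[OF run fin arc, of ?k]
  proof
    assume le: "?k \<le> card (sent x ?k c i)"
    have fb: "finite (branch c i)"
      using fin branch_subset finite_subset by (metis finite_Diff)
    have "card (message S ` branch c i) \<le> card (branch c i)"
      using fb by (rule card_image_le)
    also have "\<dots> \<le> card (pverts G - {i})"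
      using fin branch_subset by (intro card_mono) auto
    also have "\<dots> = ?k"
      using i by simp
    finally have "card (message S ` branch c i) \<le> card (sent x ?k c i)"
      using le by (rule order_trans)
    with finite_imageI[OF fb] sent_subset_branch[OF run arc] show ?thesis
      by (rule card_seteq)
  qed
  then have "held G S x ?k i = message S ` (insert i (\<Union>c\<in>{c. (c, i) \<in> parcs G}. branch c i))"
    by (simp add: held_eq image_UN)
  then show ?thesis
    by (simp only: verts_eq_branches[OF i, symmetric])
qed

end

section \<open>Round bounds for selective flooding\<close>

theorem theorem1:
  fixes G :: "nat pair_pre_digraph" and n :: nat and S :: "nat \<Rightarrow> 'm"
  assumes "pair_wf_digraph G"
    and "pverts G = {1..n}"
    and "strongly_connected G"
  shows "(undirected_tree G \<longrightarrow>
           (\<forall>x. dsf_undirected_run G S x \<longrightarrow>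
             (\<forall>i\<in>pverts G. held G S x (n - 1) i = message S ` pverts G))) \<and>
         (\<forall>x. dsf_directed_run G S x \<longrightarrow>
           (\<forall>i\<in>pverts G. held G S x (n + diameter G - 1) i = message S ` pverts G))"
proof -
  have fin: "finite (pverts G)" and card: "card (pverts G) = n"
    using assms(2) by simp_all
  have "held G S x (n - 1) i = message S ` pverts G"
    if "undirected_tree G" "dsf_undirected_run G S x" "i \<in> pverts G" for x i
  proof -
    have "tree_network G"
      using assms(1) that(1) by (intro tree_network.intro tree_network_axioms.intro)
    from tree_network.undirected_complete[OF this that(2) fin that(3)] show ?thesis
      using card by simp
  qed
  moreover have "held G S x (n + diameter G - 1) i = message S ` pverts G"
    if "dsf_directed_run G S x" "i \<in> pverts G" for x i
    using pair_wf_digraph.directed_complete[OF assms(1) that(1) fin assms(3) that(2)] card by simp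
  ultimately show ?thesis by blast
qed

end
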